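(* Let $Q\in\mathcal{S}^n$. Then $Q\in\mathcal{S}^n\setminus\mathcal{Q}^n$ (equivalently, $\ell(Q)<\nu(Q)$) if and only if there exist $\lambda\in\mathbb{R}$ and $M\in\partial\,\mathcal{COP}^n\setminus\mathcal{SPN}^n$ such that $$Q=\lambda E+M.$$ Furthermore, for any such decomposition, we have $\lambda=\nu(Q)$ and $\Omega(Q)=\mathbf{V}^M$.
   Context: $\mathcal{S}^n$ is the space of real symmetric $n\times n$ matrices, with trace inner product $\langle U,V\rangle=\sum_{i,j}U_{ij}V_{ij}$; $e\in\mathbb{R}^n$ is the all-ones vector, $E=ee^T$; $\Delta_n=\{x\in\mathbb{R}^n: e^Tx=1,\ x\ge 0\}$. $\mathcal{DN}^n$ is the cone of matrices in $\mathcal{S}^n$ that are both positive semidefinite and entrywise nonnegative. $\mathcal{SPN}^n$ is the cone of matrices in $\mathcal{S}^n$ that are the sum of a positive semidefinite matrix and an entrywise nonnegative symmetric matrix. $\mathcal{COP}^n=\{M\in\mathcal{S}^n: u^TMu\ge0\ \text{for all } u\in\mathbb{R}^n,\ u\ge0\}$ is the copositive cone, and its boundary is $\partial\,\mathcal{COP}^n=\{M\in\mathcal{COP}^n:\exists\,u\in\Delta_n\text{ with }u^TMu=0\}$. For $M\in\partial\,\mathcal{COP}^n$, $\mathbf{V}^M=\{u\in\Delta_n:u^TMu=0\}$. For $Q\in\mathcal{S}^n$: $\nu(Q)=\min\{x^TQx: x\in\Delta_n\}$, $\Omega(Q)=\{x\in\Delta_n:x^TQx=\nu(Q)\}$, and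 $\ell(Q)=\min\{\langle Q,X\rangle:\langle E,X\rangle=1,\ X\in\mathcal{DN}^n\}$. $\mathcal{Q}^n=\{Q\in\mathcal{S}^n:\ell(Q)=\nu(Q)\}$; one always has $\ell(Q)\le\nu(Q)$. *)

theory Defs
  imports "HOL-Analysis.Analysis"
begin

text \<open>
  The dimension \<open>n \<ge> 1\<close> is the cardinality of the index type \<open>'n\<close>.  The library inner product on
  \<open>real ^ 'n ^ 'n\<close> is the trace inner product, see \<open>inner_matrix_eq\<close> below.
\<close>

definition sym_mats :: "(real ^ 'n ^ 'n) set" where
  "sym_mats = {M. transpose M = M}"

definition qform :: "real ^ 'n ^ 'n \<Rightarrow> real ^ 'n \<Rightarrow> real" where
  "qform M x = x \<bullet> (M *v x)"

definition ones_vec :: "real ^ 'n" where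
  "ones_vec = (\<chi> i. 1)"

definition ones_mat :: "real ^ 'n ^ 'n" where
  "ones_mat = (\<chi> i j. ones_vec $ i * ones_vec $ j)"

definition std_simplex :: "(real ^ 'n) set" where
  "std_simplex = {x. ones_vec \<bullet> x = 1 \<and> (\<forall>i. 0 \<le> x $ i)}"

definition psd_cone :: "(real ^ 'n ^ 'n) set" where
  "psd_cone = {M \<in> sym_mats. \<forall>x. 0 \<le> qform M x}"

definition nonneg_cone :: "(real ^ 'n ^ 'n) set" where
  "nonneg_cone = {M \<in> sym_mats. \<forall>i j. 0 \<le> M $ i $ j}"

definition dn_cone :: "(real ^ 'n ^ 'n) set" where
  "dn_cone = psd_cone \<inter> nonneg_cone"

definition spn_cone :: "(real ^ 'n ^ 'n) set" where
  "spn_cone = {P + N | P N. P \<in> psd_cone \<and> N \<in> nonneg_cone}"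

definition cop_cone :: "(real ^ 'n ^ 'n) set" where
  "cop_cone = {M \<in> sym_mats. \<forall>u. (\<forall>i. 0 \<le> u $ i) \<longrightarrow> 0 \<le> qform M u}"

definition cop_boundary :: "(real ^ 'n ^ 'n) set" where
  "cop_boundary = {M \<in> cop_cone. \<exists>u \<in> std_simplex. qform M u = 0}"

definition simplex_zeros :: "real ^ 'n ^ 'n \<Rightarrow> (real ^ 'n) set" where
  "simplex_zeros M = {u \<in> std_simplex. qform M u = 0}"

text \<open>
  \<open>nu Q\<close> and \<open>ell Q\<close> are minima, not just infima: \<open>LEAST\<close> is the least element of the set of
  attained values.  It exists by \<open>nu_attained\<close> and \<open>ell_attained\<close> below.
\<close>

definition nu :: "real ^ 'n ^ 'n \<Rightarrow> real" where
  "nu Q = (LEAST v. v \<in> qform Q ` std_simplex)"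

definition Omega :: "real ^ 'n ^ 'n \<Rightarrow> (real ^ 'n) set" where
  "Omega Q = {x \<in> std_simplex. qform Q x = nu Q}"

definition ell_feasible :: "(real ^ 'n ^ 'n) set" where
  "ell_feasible = {X \<in> dn_cone. ones_mat \<bullet> X = 1}"

definition ell :: "real ^ 'n ^ 'n \<Rightarrow> real" where
  "ell Q = (LEAST v. v \<in> (\<lambda>X. Q \<bullet> X) ` ell_feasible)"

definition exact_mats :: "(real ^ 'n ^ 'n) set" where
  "exact_mats = {Q \<in> sym_mats. ell Q = nu Q}"

lemma inner_matrix_eq:
  fixes U V :: "real ^ 'n ^ 'n"
  shows "U \<bullet> V = (\<Sum>i\<in>UNIV. \<Sum>j\<in>UNIV. U $ i $ j * V $ i $ j)"
  by (simp add: inner_vec_def)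

lemma LEAST_image_attained:
  fixes f :: "'a::topological_space \<Rightarrow> real"
  assumes "compact S" "S \<noteq> {}" "continuous_on S f"
  shows "\<exists>x\<in>S. f x = (LEAST v. v \<in> f ` S) \<and> (\<forall>y\<in>S. f x \<le> f y)"
proof -
  obtain x where x: "x \<in> S" "\<forall>y\<in>S. f x \<le> f y"
    using continuous_attains_inf[OF assms] by blast
  have "(LEAST v. v \<in> f ` S) = f x"
    by (rule Least_equality) (use x in auto)
  with x show ?thesis by auto
qed

lemma continuous_on_qform:
  fixes Q :: "real ^ 'n ^ 'n"
  shows "continuous_on S (qform Q)"
  unfolding qform_def
  by (intro continuous_intros linear_continuous_on matrix_vector_mul_bounded_linear)

lemma compact_std_simplex: "compact (std_simplex :: (real ^ 'n) set)"
proof -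
  have eq: "std_simplex = {x :: real ^ 'n. ones_vec \<bullet> x = 1} \<inter> (\<Inter>i. {x. 0 \<le> x $ i})"
    by (auto simp: std_simplex_def)
  have "closed (std_simplex :: (real ^ 'n) set)"
    unfolding eq by (intro closed_Int closed_INT ballI closed_Collect_eq closed_Collect_le continuous_intros)
  moreover have "norm x \<le> 1" if "x \<in> std_simplex" for x :: "real ^ 'n"
  proof -
    have "norm x \<le> (\<Sum>i\<in>UNIV. \<bar>x $ i\<bar>)" by (rule norm_le_l1_cart)
    also have "\<dots> = ones_vec \<bullet> x"
      using that by (simp add: std_simplex_def ones_vec_def inner_vec_def)
    finally show ?thesis using that by (simp add: std_simplex_def)
  qed
  hence "bounded (std_simplex :: (real ^ 'n) set)" by (auto intro: boundedI)
  ultimately show ?thesis by (simp add: compact_eq_bounded_closed)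
qed

lemma axis_in_std_simplex: "axis k 1 \<in> (std_simplex :: (real ^ 'n) set)"
  by (auto simp: std_simplex_def ones_vec_def inner_vec_def axis_def)

theorem nu_attained:
  fixes Q :: "real ^ 'n ^ 'n"
  shows "\<exists>x\<in>std_simplex. qform Q x = nu Q \<and> (\<forall>y\<in>std_simplex. qform Q x \<le> qform Q y)"
  unfolding nu_def
  by (rule LEAST_image_attained[OF compact_std_simplex _ continuous_on_qform])
     (use axis_in_std_simplex in blast)

lemma compact_ell_feasible: "compact (ell_feasible :: (real ^ 'n ^ 'n) set)"
proof -
  have eq: "ell_feasible = {X :: real ^ 'n ^ 'n. ones_mat \<bullet> X = 1} \<inter> (\<Inter>i. \<Inter>j. {X. X $ j $ i = X $ i $ j})
      \<inter> (\<Inter>i. \<Inter>j. {X. 0 \<le> X $ i $ j}) \<inter> (\<Inter>x. {X. 0 \<le> (\<Sum>i\<in>UNIV. x $ i * (\<Sum>j\<in>UNIV. X $ i $ j * x $ j))})"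
    by (auto simp: ell_feasible_def dn_cone_def psd_cone_def nonneg_cone_def sym_mats_def qform_def
          transpose_def vec_eq_iff inner_vec_def matrix_vector_mult_def)
  have "closed (ell_feasible :: (real ^ 'n ^ 'n) set)"
    unfolding eq by (intro closed_Int closed_INT ballI closed_Collect_eq closed_Collect_le continuous_intros)
  moreover have "norm X \<le> 1" if "X \<in> ell_feasible" for X :: "real ^ 'n ^ 'n"
  proof -
    have nn: "0 \<le> X $ i $ j" for i j
      using that by (auto simp: ell_feasible_def dn_cone_def nonneg_cone_def)
    have "norm X \<le> (\<Sum>i\<in>UNIV. norm (X $ i))"
      unfolding norm_vec_def by (rule L2_set_le_sum) auto
    also have "\<dots> \<le> (\<Sum>i\<in>UNIV. \<Sum>j\<in>UNIV. \<bar>X $ i $ j\<bar>)"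
      by (intro sum_mono norm_le_l1_cart)
    also have "\<dots> = ones_mat \<bullet> X"
      using nn by (simp add: ones_mat_def ones_vec_def inner_vec_def)
    finally show ?thesis using that by (simp add: ell_feasible_def)
  qed
  hence "bounded (ell_feasible :: (real ^ 'n ^ 'n) set)" by (auto intro: boundedI)
  ultimately show ?thesis by (simp add: compact_eq_bounded_closed)
qed

lemma ell_feasible_nonempty: "(ell_feasible :: (real ^ 'n ^ 'n) set) \<noteq> {}"
proof -
  fix k :: 'n
  define X :: "real ^ 'n ^ 'n" where "X = (\<chi> i j. if i = k \<and> j = k then 1 else 0)"
  have row: "(\<Sum>j\<in>UNIV. X $ i $ j * x $ j) = (if i = k then x $ k else 0)" for i and x :: "real ^ 'n"
    by (cases "i = k") (simp_all add: X_def if_distrib[of "\<lambda>c. c * _"] cong: if_cong)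
  have "qform X x = x $ k * x $ k" for x
    by (simp add: qform_def inner_vec_def matrix_vector_mult_def row if_distrib[of "\<lambda>c. _ * c"] cong: if_cong)
  moreover have "X \<in> sym_mats"
    by (auto simp: sym_mats_def transpose_def vec_eq_iff X_def)
  moreover have "ones_mat \<bullet> X = 1"
    using row[of _ "ones_vec"]
    by (simp add: ones_mat_def ones_vec_def inner_vec_def)
  ultimately have "X \<in> ell_feasible"
    by (auto simp: ell_feasible_def dn_cone_def psd_cone_def nonneg_cone_def) (simp add: X_def)
  thus ?thesis by blast
qed

theorem ell_attained:
  fixes Q :: "real ^ 'n ^ 'n"
  shows "\<exists>X\<in>ell_feasible. Q \<bullet> X = ell Q \<and> (\<forall>Y\<in>ell_feasible. Q \<bullet> X \<le> Q \<bullet> Y)"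
  unfolding ell_def
  by (rule LEAST_image_attained[OF compact_ell_feasible ell_feasible_nonempty])
     (intro continuous_intros)

end

theory Submission
  imports Defs
begin

text \<open>
  Write \<open>E\<close> for \<open>ones_mat\<close>.  The form of \<open>E\<close> is constantly \<open>1\<close> on the simplex, so subtracting
  \<open>lam *\<^sub>R E\<close> shifts the values of \<open>qform Q\<close> on the simplex by \<open>lam\<close>.  Copositivity only
  has to be tested on the simplex, hence \<open>Q - lam *\<^sub>R E\<close> lies on the boundary of the copositive
  cone exactly when the minimum of the shifted form is \<open>0\<close>, that is when \<open>lam = nu Q\<close>, and then its
  zeros are the minimisers of \<open>qform Q\<close>.  So everything comes down to the equivalence of
  \<open>nu Q \<le> ell Q\<close> and \<open>Q - nu Q *\<^sub>R E \<in> spn_cone\<close>.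

  This equivalence holds because \<open>dn_cone\<close> and \<open>spn_cone\<close> are dual to each other in the trace
  inner product: \<open>nu Q \<le> ell Q\<close> says that \<open>Q - nu Q *\<^sub>R E\<close> has nonnegative inner product with
  every feasible matrix, that is, up to scaling, with every doubly nonnegative one.  One half of the
  duality is \<open>inner_spn_dn_nonneg\<close>; it rests on the trace inner product of two positive semidefinite
  matrices being nonnegative, which \<open>inner_psd_psd_nonneg\<close> obtains by splitting off rank-one matrices
  through Schur complements.  The other half, \<open>in_spn_coneI\<close>, separates a matrix outside
  \<open>spn_cone\<close> from it by a hyperplane, whose symmetrised normal is doubly nonnegative.  This needs
  \<open>spn_cone\<close> to be closed: in a sum of a positive semidefinite and a nonnegative matrix,
  the trace of the sum bounds the positive semidefinite summand.
\<close>

section \<open>Quadratic forms and rank-one matrices\<close>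

definition outer :: "real ^ 'n \<Rightarrow> real ^ 'n ^ 'n" where
  "outer x = (\<chi> i j. x $ i * x $ j)"

lemma ones_mat_eq_outer: "ones_mat = outer ones_vec"
  by (simp add: ones_mat_def outer_def)

lemma qform_eq_inner_outer: "qform M x = M \<bullet> outer x"
  by (simp add: qform_def inner_vec_def matrix_vector_mult_def outer_def sum_distrib_left
      algebra_simps)

lemma inner_outer_outer: "outer x \<bullet> outer y = (x \<bullet> y)\<^sup>2"
  by (simp add: inner_vec_def outer_def power2_eq_square sum_product algebra_simps)

lemma qform_axis: "qform M (axis k 1) = M $ k $ k"
  by (simp add: qform_def inner_axis' matrix_vector_mul_component inner_axis)

lemma qform_scaleR: "qform M (c *\<^sub>R x) = c\<^sup>2 * qform M x"
  by (simp add: qform_def matrix_vector_mult_scaleR power2_eq_square)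

lemma outer_sym: "outer x \<in> sym_mats"
  by (simp add: outer_def sym_mats_def transpose_def vec_eq_iff)

lemma outer_psd: "outer x \<in> psd_cone"
  by (simp add: psd_cone_def outer_sym qform_eq_inner_outer inner_outer_outer)

lemma sym_mats_entry: "M \<in> sym_mats \<Longrightarrow> M $ i $ j = M $ j $ i"
  by (metis (mono_tags, lifting) mem_Collect_eq sym_mats_def transpose_def vec_lambda_beta)

lemma sym_matsI: "(\<And>i j. M $ i $ j = M $ j $ i) \<Longrightarrow> M \<in> sym_mats"
  by (simp add: sym_mats_def transpose_def vec_eq_iff)

lemma subspace_sym_mats: "subspace sym_mats"
  unfolding subspace_def
  by (auto intro!: sym_matsI simp: sym_mats_entry)

section \<open>Positive semidefinite matrices\<close>

lemma qform_add_axis: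
  fixes P :: "real ^ 'n ^ 'n"
  assumes "P \<in> sym_mats"
  shows "qform P (x + t *\<^sub>R axis k 1) = qform P x + 2 * t * (P $ k \<bullet> x) + t\<^sup>2 * P $ k $ k"
proof -
  have "x \<bullet> (P *v axis k 1) = P $ k \<bullet> x"
    using sym_mats_entry[OF assms]
    by (simp add: matrix_vector_mult_basis column_def inner_vec_def mult.commute)
  moreover have "axis k 1 \<bullet> (P *v x) = P $ k \<bullet> x"
    by (simp add: inner_axis' matrix_vector_mul_component)
  moreover have "axis k 1 \<bullet> (P *v axis k 1) = P $ k $ k"
    using qform_axis[of P k] by (simp add: qform_def)
  ultimately show ?thesis
    by (simp add: qform_def matrix_vector_right_distrib matrix_vector_mult_scaleR inner_add
        power2_eq_square algebra_simps)
qed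

lemma psd_diag_nonneg:
  assumes "P \<in> psd_cone"
  shows "0 \<le> P $ k $ k"
proof -
  have "0 \<le> qform P (axis k 1)" using assms by (simp add: psd_cone_def)
  then show ?thesis by (simp add: qform_axis)
qed

text \<open>
  This is the Cauchy-Schwarz inequality for the semi-inner product of \<open>P\<close>, applied to \<open>x\<close> and the
  \<open>k\<close>-th unit vector.
\<close>

lemma psd_row_bound:
  fixes P :: "real ^ 'n ^ 'n"
  assumes "P \<in> psd_cone"
  shows "(P $ k \<bullet> x)\<^sup>2 \<le> P $ k $ k * qform P x"
proof -
  define d b q where "d = P $ k $ k" and "b = P $ k \<bullet> x" and "q = qform P x"
  have poly: "0 \<le> q + 2 * t * b + t\<^sup>2 * d" for t
    using assms qform_add_axis[of P x t k, symmetric] by (simp add: psd_cone_def d_def b_def q_def)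
  have "0 \<le> d" unfolding d_def by (rule psd_diag_nonneg[OF assms])
  \<comment> \<open>If \<open>d > 0\<close>, the bound says that the minimum over \<open>t\<close>, attained at \<open>- b / d\<close>, is nonnegative.
    If \<open>d = 0\<close>, the expression is affine in \<open>t\<close> and takes the value \<open>- 1\<close> unless its slope vanishes.\<close>
  have "b\<^sup>2 \<le> d * q"
  proof (cases "d = 0")
    case True
    have "b = 0"
    proof (rule ccontr)
      assume "b \<noteq> 0"
      with poly[of "- (q + 1) / (2 * b)"] True show False by (simp add: field_simps)
    qed
    with True show ?thesis by simp
  next
    case False
    with \<open>0 \<le> d\<close> have "0 < d" by simp
    have "q + 2 * (- b / d) * b + (- b / d)\<^sup>2 * d = q - b\<^sup>2 / d"
      using \<open>0 < d\<close> by (simp add: field_simps power2_eq_square)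
    with poly[of "- b / d"] have "b\<^sup>2 / d \<le> q" by simp
    with \<open>0 < d\<close> show ?thesis by (simp add: field_simps)
  qed
  then show ?thesis by (simp add: d_def b_def q_def)
qed

text \<open>
  For a nonzero row \<open>v = P $ k\<close>, subtracting \<open>(1 / P $ k $ k) *\<^sub>R outer v\<close> keeps \<open>P\<close> positive
  semidefinite (the form stays nonnegative by \<open>psd_row_bound\<close>), clears row \<open>k\<close>, and creates no
  new nonzero row.  So \<open>P\<close> is a nonnegative combination of rank-one matrices \<open>outer v\<close>, and \<open>outer v \<bullet> X = qform X v \<ge> 0\<close>.
\<close>

lemma inner_psd_psd_nonneg:
  fixes P X :: "real ^ 'n ^ 'n"
  assumes "P \<in> psd_cone" "X \<in> psd_cone"
  shows "0 \<le> P \<bullet> X"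
  using assms(1)
proof (induction "card {i. P $ i \<noteq> 0}" arbitrary: P rule: less_induct)
  case less
  have sym: "P \<in> sym_mats" using less.prems by (simp add: psd_cone_def)
  show ?case
  proof (cases "P = 0")
    case False
    then obtain k where k: "P $ k \<noteq> 0" by (auto simp: vec_eq_iff[of P])
    define v d where "v = P $ k" and "d = P $ k $ k"
    have "0 < (v \<bullet> v)\<^sup>2" using k by (simp add: v_def)
    also have "\<dots> \<le> d * qform P v"
      using psd_row_bound[OF less.prems] by (simp add: v_def d_def)
    finally have "0 < d"
      using psd_diag_nonneg[OF less.prems, of k] by (cases "d = 0") (auto simp: d_def)
    define P' where "P' = P - (1 / d) *\<^sub>R outer v"
    have P'_row: "P' $ i = P $ i - (P $ i $ k / d) *\<^sub>R P $ k" for i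
      using sym_mats_entry[OF sym, of k i]
      by (simp add: P'_def outer_def v_def vec_eq_iff)
    have "P' \<in> sym_mats"
      unfolding P'_def
      by (intro subspace_diff subspace_scale subspace_sym_mats sym outer_sym)
    moreover have "0 \<le> qform P' x" for x
    proof -
      have "qform P' x = qform P x - (v \<bullet> x)\<^sup>2 / d"
        by (simp add: P'_def qform_eq_inner_outer inner_diff_left inner_outer_outer)
      moreover have "(v \<bullet> x)\<^sup>2 / d \<le> qform P x"
        using psd_row_bound[OF less.prems, of k x] \<open>0 < d\<close> by (simp add: v_def d_def field_simps)
      ultimately show ?thesis by simp
    qed
    ultimately have "P' \<in> psd_cone" by (simp add: psd_cone_def)
    moreover have "{i. P' $ i \<noteq> 0} \<subset> {i. P $ i \<noteq> 0}"
    proof -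
      have "P' $ k = 0" using \<open>0 < d\<close> by (simp add: P'_row d_def)
      moreover have "P' $ i = 0" if "P $ i = 0" for i using that by (simp add: P'_row)
      ultimately show ?thesis using k by auto
    qed
    ultimately have "0 \<le> P' \<bullet> X"
      by (intro less.hyps psubset_card_mono) auto
    moreover have "0 \<le> outer v \<bullet> X"
      using assms(2) by (simp add: psd_cone_def inner_commute qform_eq_inner_outer)
    moreover have "P \<bullet> X = P' \<bullet> X + (1 / d) * (outer v \<bullet> X)"
      by (simp add: P'_def inner_diff_left)
    ultimately show ?thesis using \<open>0 < d\<close> by simp
  qed simp
qed

text \<open>
  No entry exceeds the trace in absolute value, because \<open>psd_row_bound\<close> at a unit vector says
  \<open>(P $ i $ j)\<^sup>2 \<le> P $ i $ i * P $ j $ j\<close>.  The constant is crude; some bound in terms of the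
  trace is what makes bounded pieces of the cone \<open>spn_cone\<close> compact in their first summand.
\<close>

lemma psd_norm_le_trace:
  fixes P :: "real ^ 'n ^ 'n"
  assumes "P \<in> psd_cone"
  shows "norm P \<le> real CARD('n) * real CARD('n) * trace P"
proof -
  have diag: "P $ i $ i \<le> trace P" for i
    unfolding trace_def by (rule member_le_sum) (auto simp: psd_diag_nonneg[OF assms])
  then have tr: "0 \<le> trace P" using psd_diag_nonneg[OF assms] order_trans by blast
  have entry: "\<bar>P $ i $ j\<bar> \<le> trace P" for i j
  proof -
    have "(P $ i $ j)\<^sup>2 \<le> P $ i $ i * P $ j $ j"
      using psd_row_bound[OF assms, of i "axis j 1"] by (simp add: inner_axis qform_axis)
    also have "\<dots> \<le> (trace P)\<^sup>2"
      unfolding power2_eq_square by (intro mult_mono diag psd_diag_nonneg[OF assms] tr)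
    finally show ?thesis using tr by (simp add: abs_le_square_iff[symmetric])
  qed
  have "norm P \<le> (\<Sum>i\<in>UNIV. norm (P $ i))"
    unfolding norm_vec_def by (rule L2_set_le_sum) auto
  also have "\<dots> \<le> (\<Sum>i\<in>UNIV. \<Sum>j\<in>UNIV. \<bar>P $ i $ j\<bar>)"
    by (intro sum_mono norm_le_l1_cart)
  also have "\<dots> \<le> (\<Sum>i\<in>(UNIV :: 'n set). \<Sum>j\<in>(UNIV :: 'n set). trace P)"
    by (intro sum_mono entry)
  finally show ?thesis by simp
qed

section \<open>The cone of sums of a positive semidefinite and a nonnegative matrix\<close>

lemma closed_psd_cone: "closed (psd_cone :: (real ^ 'n ^ 'n) set)"
proof -
  have eq: "psd_cone = sym_mats \<inter> (\<Inter>x. {M :: real ^ 'n ^ 'n. 0 \<le> M \<bullet> outer x})"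
    by (auto simp: psd_cone_def qform_eq_inner_outer)
  show ?thesis
    unfolding eq
    by (intro closed_Int closed_INT ballI closed_Collect_le continuous_intros
        closed_subspace subspace_sym_mats)
qed

lemma closed_nonneg_cone: "closed (nonneg_cone :: (real ^ 'n ^ 'n) set)"
proof -
  have eq: "nonneg_cone = sym_mats \<inter> (\<Inter>i j. {M :: real ^ 'n ^ 'n. 0 \<le> M $ i $ j})"
    by (auto simp: nonneg_cone_def)
  show ?thesis
    unfolding eq
    by (intro closed_Int closed_INT ballI closed_Collect_le continuous_intros
        closed_subspace subspace_sym_mats)
qed

lemma psd_cone_add: "P \<in> psd_cone \<Longrightarrow> P' \<in> psd_cone \<Longrightarrow> P + P' \<in> psd_cone"
  by (simp add: psd_cone_def qform_eq_inner_outer inner_add_left subspace_add[OF subspace_sym_mats])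

lemma psd_cone_scaleR: "P \<in> psd_cone \<Longrightarrow> 0 \<le> c \<Longrightarrow> c *\<^sub>R P \<in> psd_cone"
  by (simp add: psd_cone_def qform_eq_inner_outer subspace_scale[OF subspace_sym_mats])

lemma nonneg_cone_add: "N \<in> nonneg_cone \<Longrightarrow> N' \<in> nonneg_cone \<Longrightarrow> N + N' \<in> nonneg_cone"
  by (simp add: nonneg_cone_def subspace_add[OF subspace_sym_mats])

lemma nonneg_cone_scaleR: "N \<in> nonneg_cone \<Longrightarrow> 0 \<le> c \<Longrightarrow> c *\<^sub>R N \<in> nonneg_cone"
  by (simp add: nonneg_cone_def subspace_scale[OF subspace_sym_mats])

lemma zero_in_psd_cone: "0 \<in> psd_cone"
  using psd_cone_scaleR[OF outer_psd, of 0] by simp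

lemma zero_in_nonneg_cone: "0 \<in> nonneg_cone"
  by (auto simp: nonneg_cone_def intro: sym_matsI)

lemma psd_in_spn: "P \<in> psd_cone \<Longrightarrow> P \<in> spn_cone"
  unfolding spn_cone_def using zero_in_nonneg_cone by force

lemma nonneg_in_spn: "N \<in> nonneg_cone \<Longrightarrow> N \<in> spn_cone"
  unfolding spn_cone_def using zero_in_psd_cone by force

lemma spn_cone_scaleR: "M \<in> spn_cone \<Longrightarrow> 0 \<le> c \<Longrightarrow> c *\<^sub>R M \<in> spn_cone"
  unfolding spn_cone_def
  using psd_cone_scaleR nonneg_cone_scaleR by (fastforce simp: scaleR_add_right)

lemma spn_cone_add: "M \<in> spn_cone \<Longrightarrow> M' \<in> spn_cone \<Longrightarrow> M + M' \<in> spn_cone"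
proof -
  assume "M \<in> spn_cone" "M' \<in> spn_cone"
  then obtain P N P' N' where "M = P + N" "M' = P' + N'" "P \<in> psd_cone" "N \<in> nonneg_cone"
    "P' \<in> psd_cone" "N' \<in> nonneg_cone"
    by (auto simp: spn_cone_def)
  moreover from this have "M + M' = (P + P') + (N + N')" by simp
  ultimately show ?thesis
    unfolding spn_cone_def using psd_cone_add nonneg_cone_add by blast
qed

lemma convex_spn_cone: "convex spn_cone"
  by (intro convexI spn_cone_add spn_cone_scaleR)

text \<open>
  A sum of two closed cones need not be closed.  Here no mass can escape to infinity: the
  diagonal of the nonnegative summand only increases the trace, so on a ball the positive
  semidefinite summand ranges over a compact set, and the sum of a compact and a closed set is closed.
\<close>

lemma closed_spn_cone: "closed (spn_cone :: (real ^ 'n ^ 'n) set)"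
proof -
  have "M \<in> spn_cone" if M: "M \<in> closure spn_cone" for M :: "real ^ 'n ^ 'n"
  proof -
    define C where "C = real CARD('n) * real CARD('n) * (norm (mat 1 :: real ^ 'n ^ 'n) * (norm M + 1))"
    define K where
      "K = (\<Union>P\<in>psd_cone \<inter> cball 0 C. \<Union>N\<in>nonneg_cone. {P + N :: real ^ 'n ^ 'n})"
    have "P + N \<in> K"
      if P: "P \<in> psd_cone" and N: "N \<in> nonneg_cone" and near: "P + N \<in> ball M 1"
      for P N :: "real ^ 'n ^ 'n"
    proof -
      have "trace P \<le> trace (P + N)"
        using N by (auto simp: nonneg_cone_def trace_def intro!: sum_mono)
      also have "\<dots> = mat 1 \<bullet> (P + N)"
        by (simp add: trace_def mat_def inner_matrix_eq if_distrib[of "\<lambda>c. c * _"] cong: if_cong)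
      also have "\<dots> \<le> norm (mat 1 :: real ^ 'n ^ 'n) * norm (P + N)"
        by (rule norm_cauchy_schwarz)
      also have "norm (P + N) \<le> norm M + 1"
        using near norm_triangle_sub[of "P + N" M] by (simp add: dist_norm norm_minus_commute)
      finally have "trace P \<le> norm (mat 1 :: real ^ 'n ^ 'n) * (norm M + 1)"
        by (simp add: mult_left_mono)
      then have "real CARD('n) * real CARD('n) * trace P \<le> C"
        unfolding C_def by (intro mult_left_mono) auto
      then have "norm P \<le> C"
        using psd_norm_le_trace[OF P] by linarith
      with P N show ?thesis by (auto simp: K_def)
    qed
    then have "ball M 1 \<inter> spn_cone \<subseteq> K"
      unfolding spn_cone_def by blast
    moreover have "closed K"
      unfolding K_def
      by (intro compact_closed_sums closed_Int_compact closed_psd_cone compact_cball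
          closed_nonneg_cone)
    ultimately have "closure (ball M 1 \<inter> spn_cone) \<subseteq> K"
      by (rule closure_minimal)
    moreover have "M \<in> closure (ball M 1 \<inter> spn_cone)"
      using open_Int_closure_subset[of "ball M 1" spn_cone] M by auto
    moreover have "K \<subseteq> spn_cone" by (auto simp: K_def spn_cone_def)
    ultimately show ?thesis by blast
  qed
  then show ?thesis using closure_subset_eq by blast
qed

section \<open>Duality with the doubly nonnegative cone\<close>

lemma inner_spn_dn_nonneg:
  assumes "M \<in> spn_cone" "X \<in> dn_cone"
  shows "0 \<le> M \<bullet> X"
proof -
  obtain P N where "M = P + N" "P \<in> psd_cone" "N \<in> nonneg_cone"
    using assms(1) by (auto simp: spn_cone_def)
  moreover have "0 \<le> P \<bullet> X"
    using assms(2) \<open>P \<in> psd_cone\<close> by (auto simp: dn_cone_def intro: inner_psd_psd_nonneg)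
  moreover have "0 \<le> N \<bullet> X"
    using assms(2) \<open>N \<in> nonneg_cone\<close>
    by (auto simp: dn_cone_def nonneg_cone_def inner_matrix_eq intro!: sum_nonneg)
  ultimately show ?thesis by (simp add: inner_add_left)
qed

lemma inner_transpose:
  fixes A B :: "real ^ 'n ^ 'n"
  shows "transpose A \<bullet> B = A \<bullet> transpose B"
  unfolding inner_matrix_eq transpose_def by (simp, rule sum.swap)

text \<open>
  The normal of a hyperplane that separates \<open>M\<close> from the cone may be symmetrised, because
  \<open>M\<close> and all members of the cone are symmetric.  Testing the symmetrised normal \<open>X\<close> on rank-one
  matrices \<open>outer x\<close> shows that it is positive semidefinite, and testing it on symmetrised matrix units
  shows that it is nonnegative.
\<close>

lemma in_spn_coneI:
  fixes M :: "real ^ 'n ^ 'n"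
  assumes M: "M \<in> sym_mats" and dual: "\<And>X. X \<in> dn_cone \<Longrightarrow> 0 \<le> M \<bullet> X"
  shows "M \<in> spn_cone"
proof (rule ccontr)
  assume "M \<notin> spn_cone"
  then obtain Y b where Y: "Y \<bullet> M < b" "\<And>Z. Z \<in> spn_cone \<Longrightarrow> b < Y \<bullet> Z"
    using separating_hyperplane_closed_point[OF convex_spn_cone closed_spn_cone] by metis
  have "b < 0" using Y(2)[OF psd_in_spn[OF zero_in_psd_cone]] by simp
  have pos: "0 \<le> Y \<bullet> Z" if Z: "Z \<in> spn_cone" for Z
  proof (rule ccontr)
    assume neg: "\<not> 0 \<le> Y \<bullet> Z"
    \<comment> \<open>Scaling \<open>Z\<close> moves it within the cone onto the separating hyperplane.\<close>
    have "(b / (Y \<bullet> Z)) *\<^sub>R Z \<in> spn_cone"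
      using Z neg \<open>b < 0\<close> by (intro spn_cone_scaleR) (auto simp: divide_nonpos_neg)
    from Y(2)[OF this] neg show False by simp
  qed
  define X where "X = Y + transpose Y"
  have inner_X: "X \<bullet> Z = 2 * (Y \<bullet> Z)" if "Z \<in> sym_mats" for Z
    using that by (simp add: X_def inner_add_left inner_transpose sym_mats_def)
  have X_sym: "X \<in> sym_mats"
    by (rule sym_matsI) (simp add: X_def transpose_def)
  have "X \<in> psd_cone"
    using X_sym pos[OF psd_in_spn[OF outer_psd]]
    by (simp add: psd_cone_def qform_eq_inner_outer inner_X outer_sym)
  moreover have "0 \<le> X $ i $ j" for i j
  proof -
    define U :: "real ^ 'n ^ 'n" where "U = axis i (axis j 1)"
    have "U + transpose U \<in> nonneg_cone"
      by (auto simp: nonneg_cone_def U_def axis_def transpose_def intro!: sym_matsI)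
    then have "0 \<le> Y \<bullet> (U + transpose U)" by (intro pos nonneg_in_spn)
    also have "\<dots> = X \<bullet> U"
      by (simp add: X_def inner_add_left inner_add_right inner_transpose)
    also have "\<dots> = X $ i $ j" by (simp add: U_def inner_axis)
    finally show ?thesis .
  qed
  ultimately have "X \<in> dn_cone" using X_sym by (simp add: dn_cone_def nonneg_cone_def)
  then have "0 \<le> M \<bullet> X" by (rule dual)
  moreover have "M \<bullet> X = 2 * (Y \<bullet> M)" using inner_X[OF M] by (simp add: inner_commute)
  ultimately show False using Y(1) \<open>b < 0\<close> by simp
qed

section \<open>The standard quadratic program and its doubly nonnegative relaxation\<close>

lemma ones_mat_sym: "ones_mat \<in> sym_mats"
  by (simp add: ones_mat_eq_outer outer_sym)

lemma outer_in_ell_feasible: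
  assumes "x \<in> std_simplex"
  shows "outer x \<in> ell_feasible"
  using assms
  by (auto simp: ell_feasible_def dn_cone_def outer_psd nonneg_cone_def outer_sym ones_mat_eq_outer
      inner_outer_outer std_simplex_def) (simp add: outer_def)

lemma ell_le_nu: "ell Q \<le> nu Q"
proof -
  obtain x where "x \<in> std_simplex" "qform Q x = nu Q" using nu_attained by blast
  moreover from this(1) have "ell Q \<le> Q \<bullet> outer x"
    using ell_attained[of Q] outer_in_ell_feasible by metis
  ultimately show ?thesis by (simp add: qform_eq_inner_outer)
qed

text \<open>
  A nonzero nonnegative matrix has positive inner product with \<open>ones_mat\<close>, so it can be
  scaled to be feasible.  Therefore \<open>t \<le> ell Q\<close> holds iff \<open>Q - t *\<^sub>R ones_mat\<close> lies
  in the dual of \<open>dn_cone\<close>, and this dual is \<open>spn_cone\<close>.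
\<close>

lemma le_ell_iff_spn:
  fixes Q :: "real ^ 'n ^ 'n"
  assumes "Q \<in> sym_mats"
  shows "t \<le> ell Q \<longleftrightarrow> Q - t *\<^sub>R ones_mat \<in> spn_cone"
proof
  assume spn: "Q - t *\<^sub>R ones_mat \<in> spn_cone"
  obtain X where X: "X \<in> ell_feasible" "Q \<bullet> X = ell Q" using ell_attained by blast
  have "0 \<le> (Q - t *\<^sub>R ones_mat) \<bullet> X"
    using X(1) by (intro inner_spn_dn_nonneg spn) (simp add: ell_feasible_def)
  then show "t \<le> ell Q" using X by (simp add: inner_diff_left ell_feasible_def)
next
  assume le: "t \<le> ell Q"
  show "Q - t *\<^sub>R ones_mat \<in> spn_cone"
  proof (rule in_spn_coneI)
    show "Q - t *\<^sub>R ones_mat \<in> sym_mats"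
      by (intro subspace_diff subspace_scale subspace_sym_mats assms ones_mat_sym)
  next
    fix X :: "real ^ 'n ^ 'n"
    assume X: "X \<in> dn_cone"
    have nn: "0 \<le> X $ i $ j" for i j using X by (simp add: dn_cone_def nonneg_cone_def)
    define s where "s = ones_mat \<bullet> X"
    have s: "s = (\<Sum>i\<in>UNIV. \<Sum>j\<in>UNIV. X $ i $ j)"
      by (simp add: s_def inner_matrix_eq ones_mat_def ones_vec_def)
    show "0 \<le> (Q - t *\<^sub>R ones_mat) \<bullet> X"
    proof (cases "s = 0")
      case True
      then have "X = 0"
        using nn by (simp add: s vec_eq_iff sum_nonneg_eq_0_iff sum_nonneg)
      then show ?thesis by simp
    next
      case False
      then have "0 < s" using nn by (simp add: s less_le sum_nonneg)
      have "(1 / s) *\<^sub>R X \<in> ell_feasible"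
        using X \<open>0 < s\<close>
        by (simp add: ell_feasible_def dn_cone_def psd_cone_scaleR nonneg_cone_scaleR s_def)
      then have "ell Q \<le> Q \<bullet> ((1 / s) *\<^sub>R X)" using ell_attained[of Q] by metis
      with le have "t \<le> (Q \<bullet> X) / s" by simp
      with \<open>0 < s\<close> have "t * s \<le> Q \<bullet> X" by (simp add: pos_le_divide_eq)
      then show ?thesis by (simp add: inner_diff_left s_def)
    qed
  qed
qed

lemma qform_shift_ones:
  assumes "x \<in> std_simplex"
  shows "qform (t *\<^sub>R ones_mat + M) x = t + qform M x"
  using assms
  by (simp add: qform_eq_inner_outer inner_add_left ones_mat_eq_outer inner_outer_outer
      std_simplex_def)

text \<open>
  The cone of nonnegative vectors consists of \<open>0\<close> and the positive multiples of points of the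
  simplex, and a quadratic form is homogeneous.
\<close>

lemma cop_cone_iff_simplex:
  "M \<in> cop_cone \<longleftrightarrow> M \<in> sym_mats \<and> (\<forall>x\<in>std_simplex. 0 \<le> qform M x)"
proof -
  have "0 \<le> qform M u"
    if simplex: "\<And>x. x \<in> std_simplex \<Longrightarrow> 0 \<le> qform M x" and u: "\<And>i. 0 \<le> u $ i" for u
  proof -
    define s where "s = ones_vec \<bullet> u"
    have s: "s = (\<Sum>i\<in>UNIV. u $ i)" by (simp add: s_def ones_vec_def inner_vec_def)
    show ?thesis
    proof (cases "s = 0")
      case True
      then have "u = 0" using u by (simp add: s vec_eq_iff sum_nonneg_eq_0_iff)
      then show ?thesis by (simp add: qform_def)
    next
      case False
      then have "0 < s" using u by (simp add: s less_le sum_nonneg)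
      then have "(1 / s) *\<^sub>R u \<in> std_simplex" using u by (simp add: std_simplex_def s_def)
      from simplex[OF this] \<open>0 < s\<close> show ?thesis
        by (simp add: qform_scaleR zero_le_mult_iff)
    qed
  qed
  then show ?thesis by (auto simp: cop_cone_def std_simplex_def)
qed

lemma cop_boundary_iff_nu:
  fixes Q :: "real ^ 'n ^ 'n"
  assumes "Q \<in> sym_mats"
  shows "Q - t *\<^sub>R ones_mat \<in> cop_boundary \<longleftrightarrow> t = nu Q"
proof -
  obtain x where x: "x \<in> std_simplex" "qform Q x = nu Q"
    and min: "\<And>y. y \<in> std_simplex \<Longrightarrow> nu Q \<le> qform Q y"
    using nu_attained[of Q] by metis
  have shift: "qform (Q - t *\<^sub>R ones_mat) y = qform Q y - t" if "y \<in> std_simplex" for y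
    using qform_shift_ones[OF that, of t "Q - t *\<^sub>R ones_mat"] by simp
  have "Q - t *\<^sub>R ones_mat \<in> sym_mats"
    by (intro subspace_diff subspace_scale subspace_sym_mats assms ones_mat_sym)
  then have "Q - t *\<^sub>R ones_mat \<in> cop_boundary \<longleftrightarrow>
      (\<forall>y\<in>std_simplex. t \<le> qform Q y) \<and> (\<exists>y\<in>std_simplex. qform Q y = t)"
    by (simp add: cop_boundary_def cop_cone_iff_simplex shift cong: ball_cong bex_cong)
  also have "\<dots> \<longleftrightarrow> t = nu Q"
    using x min by (metis order_antisym)
  finally show ?thesis .
qed

lemma Omega_eq_simplex_zeros: "Omega Q = simplex_zeros (Q - nu Q *\<^sub>R ones_mat)"
  using qform_shift_ones[where t = "nu Q" and M = "Q - nu Q *\<^sub>R ones_mat"]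
  by (auto simp: Omega_def simplex_zeros_def)

theorem proposition6p1:
  fixes Q :: "real ^ 'n ^ 'n"
  assumes "Q \<in> sym_mats"
  shows "(Q \<in> sym_mats - exact_mats \<longleftrightarrow> ell Q < nu Q)
    \<and> (Q \<in> sym_mats - exact_mats \<longleftrightarrow>
         (\<exists>(lam::real). \<exists>M \<in> cop_boundary - spn_cone. Q = lam *\<^sub>R ones_mat + M))
    \<and> (\<forall>(lam::real). \<forall>M \<in> cop_boundary - spn_cone. Q = lam *\<^sub>R ones_mat + M \<longrightarrow>
         lam = nu Q \<and> Omega Q = simplex_zeros M)"
proof (intro conjI allI ballI impI)
  show strict: "Q \<in> sym_mats - exact_mats \<longleftrightarrow> ell Q < nu Q"
    using assms ell_le_nu[of Q] by (auto simp: exact_mats_def)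
  have decomp: "Q = lam *\<^sub>R ones_mat + M \<longleftrightarrow> M = Q - lam *\<^sub>R ones_mat" for lam M
    by (auto simp: algebra_simps)
  have "(\<exists>lam. \<exists>M \<in> cop_boundary - spn_cone. Q = lam *\<^sub>R ones_mat + M)
      \<longleftrightarrow> Q - nu Q *\<^sub>R ones_mat \<notin> spn_cone"
    unfolding decomp using cop_boundary_iff_nu[OF assms] by auto
  also have "\<dots> \<longleftrightarrow> ell Q < nu Q"
    using le_ell_iff_spn[OF assms, of "nu Q"] by auto
  finally show "Q \<in> sym_mats - exact_mats \<longleftrightarrow>
      (\<exists>lam. \<exists>M \<in> cop_boundary - spn_cone. Q = lam *\<^sub>R ones_mat + M)"
    using strict by blast
  fix lam :: real and M :: "real ^ 'n ^ 'n"
  assume M: "M \<in> cop_boundary - spn_cone" "Q = lam *\<^sub>R ones_mat + M"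
  then show lam: "lam = nu Q"
    using cop_boundary_iff_nu[OF assms, of lam] by (auto simp: decomp)
  show "Omega Q = simplex_zeros M"
    using M(2) unfolding decomp lam by (simp add: Omega_eq_simplex_zeros)
qed

end
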